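(* Let $a,b$ be integers with $0<a<b$ and $\gcd(a,b)=1$, put $P=\{0,a,b\}$, and suppose $P\ne\{0,1,2\}$. Then every finite nonempty set $A\subset\mathbb Z$ of size $n$ satisfies $$M_P^+(A)\le \frac{99}{400}n^2+(n-1).$$ Equivalently, $\gamma_P^+\le \frac{99}{400}$.
   Context: For $P=\{0,a,b\}$ and a finite set $A\subset\mathbb Z$, $M_P^+(A)=\#\{(x,d)\in\mathbb Z^2: d>0,\ x\in A,\ x+ad\in A,\ x+bd\in A\}$. Further, $m_P^+(n)=\max_{|A|=n}M_P^+(A)$, the maximum over all $A\subset\mathbb Z$ with $|A|=n$, and $\gamma_P^+=\limsup_{n\to\infty} m_P^+(n)/n^2$. *)

theory Defs
  imports Complex_Main "HOL-Library.Extended_Real" "HOL-Library.Liminf_Limsup"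
begin

text \<open>
  For a pattern \<open>P = {0, a, b}\<close> the condition \<open>\<forall>p\<in>P. x + p * d \<in> A\<close> says
  \<open>x \<in> A\<close>, \<open>x + a * d \<in> A\<close> and \<open>x + b * d \<in> A\<close>.  If \<open>P\<close> has at least two elements and
  \<open>A\<close> is finite, the set counted below is finite, so \<open>card\<close> is its true size.
\<close>

definition M_plus :: "int set \<Rightarrow> int set \<Rightarrow> nat" where
  "M_plus P A = card {(x, d). d > 0 \<and> (\<forall>p\<in>P. x + p * d \<in> A)}"

text \<open>
  For such \<open>P\<close> the values below are bounded by \<open>n\<^sup>2\<close> (a pair is determined by two of its
  points), so the maximum is taken over a finite nonempty set.
\<close>

definition m_plus :: "int set \<Rightarrow> nat \<Rightarrow> nat" where
  "m_plus P n = Max {M_plus P A | A. finite A \<and> card A = n}"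

definition gamma_plus :: "int set \<Rightarrow> ereal" where
  "gamma_plus P = limsup (\<lambda>n. ereal (real (m_plus P n) / real n ^ 2))"

end

theory Submission imports Defs
begin

text \<open>
  Write \<open>c = b - a\<close>, so that the counted patterns are the triples \<open>x < y < z\<close> in \<open>A\<close> with
  \<open>y = x + a d\<close>, \<open>z = y + c d\<close>.  Any two of the three points determine the third.  Split \<open>A\<close> into
  a lower half and an upper half.  A triple with \<open>y\<close> in the lower half is determined by the pair
  \<open>(x, y)\<close> of the lower half, one with \<open>y\<close> in the upper half by the pair \<open>(y, z)\<close> of the upper half;
  this gives the trivial bound of about \<open>n\<^sup>2 / 4\<close>.  The theorem asks for at least about \<open>n\<^sup>2 / 400\<close>
  of these pairs to be wasted, that is, not to extend to a triple in \<open>A\<close>.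

  The waste is arithmetical.  As \<open>P \<noteq> {0, 1, 2}\<close> and the problem is symmetric under reflection
  (which exchanges \<open>a\<close> and \<open>c\<close>), one may assume \<open>c \<ge> 2\<close>.  Since \<open>a\<close>, \<open>b\<close> are coprime to \<open>c\<close>, for a
  power \<open>m\<close> of \<open>c\<close> the three conditions \<open>x \<equiv> y (mod m)\<close>, \<open>x \<equiv> z (mod m)\<close> and
  \<open>y \<equiv> z (mod c m)\<close> are equivalent: each says that \<open>m\<close> divides \<open>d\<close> (\<open>triples_residues\<close>).  Refining
  the residue classes modulo \<open>1, c, c\<^sup>2, \<dots>\<close> until none contains more than \<open>9 n / 10\<close> points,
  one finds a class \<open>Q\<close> modulo some \<open>m\<close> with \<open>|Q| > 9 n / 10\<close> all of whose subclasses modulo \<open>c m\<close>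
  have at most \<open>9 n / 10\<close> points (\<open>large_class_with_small_subclasses\<close>).  Put \<open>R = A - Q\<close>.

  If \<open>S\<close> is a union of subclasses of \<open>Q\<close>, then \<open>x \<in> R\<close> in every triple in which exactly one of \<open>y\<close>, \<open>z\<close>
  lies in \<open>S\<close>.  So each point of the upper half outside \<open>S\<close> is paired with a point of \<open>S\<close> there in at most
  \<open>2 |R| < n / 5\<close> of them, and its remaining pairs with \<open>S\<close> are wasted (\<open>card_middle_above_le\<close>).
  This is enough whenever some \<open>S\<close> has between \<open>0.21 n\<close> and \<open>0.49 n\<close> points in the upper half.  Otherwise a
  single subclass \<open>S\<close> fills nearly the whole upper half (\<open>subset_sum_between\<close>).  As \<open>|S| \<le> 9 n / 10\<close>, the
  lower half has not much less than \<open>n / 10\<close> points outside \<open>S\<close>, in \<open>D = Q - S\<close> or in \<open>R\<close>.  A pair in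
  \<open>D\<close> extends only by a third point of \<open>D\<close>, and the upper half has hardly any, so that about half of the pairs
  inside \<open>D\<close> are wasted.  A pair from \<open>R\<close> and \<open>S\<close> extends only to a point outside \<open>S\<close>; unless \<open>D\<close> is so
  large that its own pairs suffice, such points are too rare to serve all these pairs
  (\<open>card_middle_below_le\<close>, \<open>dominant_class_bound\<close>).  In the extreme case \<open>R = {}\<close>, \<open>|D| = n / 10\<close> this wastes
  \<open>|D|\<^sup>2 / 4 = n\<^sup>2 / 400\<close> pairs, which is where the constant comes from.
\<close>

section \<open>Ordered pairs and initial segments\<close>

lemma card_ordered_pairs:
  fixes X :: "'a::linorder set"
  assumes "finite X"
  shows "finite {(x, y). x \<in> X \<and> y \<in> X \<and> x < y}"
    and "real (card {(x, y). x \<in> X \<and> y \<in> X \<and> x < y}) = real (card X) * (real (card X) - 1) / 2"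
proof -
  have fin: "finite {(x, y). x \<in> X \<and> y \<in> X \<and> x < y}" if "finite X" for X :: "'a set"
    by (rule finite_subset[of _ "X \<times> X"]) (use that in auto)
  show "finite {(x, y). x \<in> X \<and> y \<in> X \<and> x < y}"
    by (rule fin) fact
  show "real (card {(x, y). x \<in> X \<and> y \<in> X \<and> x < y}) = real (card X) * (real (card X) - 1) / 2"
    using assms
  proof (induction X rule: finite_linorder_max_induct)
    case empty
    then show ?case by simp
  next
    case (insert b X)
    have b: "b \<notin> X" using insert by auto
    have eq: "{(x, y). x \<in> insert b X \<and> y \<in> insert b X \<and> x < y}
        = {(x, y). x \<in> X \<and> y \<in> X \<and> x < y} \<union> (\<lambda>x. (x, b)) ` X"
      using insert.hyps by auto
    have "card ({(x, y). x \<in> X \<and> y \<in> X \<and> x < y} \<union> (\<lambda>x. (x, b)) ` X)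
        = card {(x, y). x \<in> X \<and> y \<in> X \<and> x < y} + card ((\<lambda>x. (x, b)) ` X)"
      by (rule card_Un_disjoint) (use insert b fin in auto)
    moreover have "card ((\<lambda>x. (x, b)) ` X) = card X"
      by (rule card_image) (auto simp: inj_on_def)
    ultimately show ?case
      unfolding eq using insert b by (simp add: field_simps)
  qed
qed

lemma card_mixed_pairs_le:
  fixes X Y :: "'a::linorder set"
  assumes "finite X" "finite Y"
  shows "finite {(x, y). x < y \<and> (x \<in> X \<and> y \<in> Y \<or> x \<in> Y \<and> y \<in> X)}"
    and "X \<inter> Y = {} \<Longrightarrow> card {(x, y). x < y \<and> (x \<in> X \<and> y \<in> Y \<or> x \<in> Y \<and> y \<in> X)} \<le> card X * card Y"
proof -
  show "finite {(x, y). x < y \<and> (x \<in> X \<and> y \<in> Y \<or> x \<in> Y \<and> y \<in> X)}"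
    by (rule finite_subset[of _ "(X \<union> Y) \<times> (X \<union> Y)"]) (use assms in auto)
  assume "X \<inter> Y = {}"
  then have "card {(x, y). x < y \<and> (x \<in> X \<and> y \<in> Y \<or> x \<in> Y \<and> y \<in> X)} \<le> card (X \<times> Y)"
    by (intro card_inj_on_le[of "\<lambda>(x, y). if x \<in> X then (x, y) else (y, x)"])
      (use assms in \<open>auto simp: inj_on_def split: if_splits\<close>)
  then show "card {(x, y). x < y \<and> (x \<in> X \<and> y \<in> Y \<or> x \<in> Y \<and> y \<in> X)} \<le> card X * card Y"
    by (simp add: card_cartesian_product)
qed

lemma initial_segment_exists:
  fixes A :: "'a::linorder set"
  assumes "finite A" "k \<le> card A"
  obtains H where "H \<subseteq> A" "card H = k" "\<And>x y. x \<in> H \<Longrightarrow> y \<in> A - H \<Longrightarrow> x < y"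
proof -
  have "\<exists>H\<subseteq>A. card H = k \<and> (\<forall>x\<in>H. \<forall>y\<in>A - H. x < y)"
    using assms(2)
  proof (induction k)
    case 0
    then show ?case by (intro exI[of _ "{}"]) auto
  next
    case (Suc k)
    then obtain H where H: "H \<subseteq> A" "card H = k" "\<forall>x\<in>H. \<forall>y\<in>A - H. x < y" by auto
    have ne: "A - H \<noteq> {}" using H Suc.prems by (metis Diff_eq_empty_iff Suc_n_not_le_n subset_antisym)
    define w where "w = Min (A - H)"
    have w: "w \<in> A" "w \<notin> H" "\<And>y. y \<in> A - H \<Longrightarrow> w \<le> y"
      using Min_in[of "A - H"] Min_le[of "A - H"] ne assms(1) by (auto simp: w_def)
    have "finite H" using H assms(1) finite_subset by blast
    then show ?case using H w
      by (intro exI[of _ "insert w H"]) (auto simp: order.strict_iff_order)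
  qed
  then show thesis using that by blast
qed

section \<open>Triples determined by any two of their points\<close>

text \<open>
  The estimates below use the order, the three injectivity properties and nothing else about the
  triples; all arithmetic enters through the hypotheses on sets such as \<open>S\<close>, \<open>D\<close>, \<open>R\<close>.
\<close>

locale pair_determined_triples =
  fixes T :: "('a::linorder \<times> 'a \<times> 'a) set" and A :: "'a set"
  assumes finite_ground: "finite A"
    and triples_in: "(x, y, z) \<in> T \<Longrightarrow> x \<in> A \<and> y \<in> A \<and> z \<in> A"
    and increasing: "(x, y, z) \<in> T \<Longrightarrow> x < y \<and> y < z"
    and det_z: "(x, y, z) \<in> T \<Longrightarrow> (x, y, z') \<in> T \<Longrightarrow> z = z'"
    and det_x: "(x, y, z) \<in> T \<Longrightarrow> (x', y, z) \<in> T \<Longrightarrow> x = x'"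
    and det_y: "(x, y, z) \<in> T \<Longrightarrow> (x, y', z) \<in> T \<Longrightarrow> y = y'"
begin

lemma finite_triples: "finite T"
  by (rule finite_subset[of _ "A \<times> A \<times> A"]) (use triples_in finite_ground in auto)

lemma card_le_by_xy:
  assumes "V \<subseteq> T" "finite W" "\<And>x y z. (x, y, z) \<in> V \<Longrightarrow> (x, y) \<in> W"
  shows "card V \<le> card W"
  by (rule card_inj_on_le[of "\<lambda>(x, y, z). (x, y)"]) (use assms det_z in \<open>auto simp: inj_on_def, blast\<close>)

lemma card_le_by_yz:
  assumes "V \<subseteq> T" "finite W" "\<And>x y z. (x, y, z) \<in> V \<Longrightarrow> (y, z) \<in> W"
  shows "card V \<le> card W"
  by (rule card_inj_on_le[of "\<lambda>(x, y, z). (y, z)"]) (use assms det_x in \<open>auto simp: inj_on_def, blast\<close>)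

lemma card_le_by_xz:
  assumes "V \<subseteq> T" "finite W" "\<And>x y z. (x, y, z) \<in> V \<Longrightarrow> (x, z) \<in> W"
  shows "card V \<le> card W"
  by (rule card_inj_on_le[of "\<lambda>(x, y, z). (x, z)"]) (use assms det_y in \<open>auto simp: inj_on_def, blast\<close>)

text \<open>
  If \<open>y\<close> lies in the lower half \<open>L\<close> of \<open>Y\<close>, count the pairs \<open>(x, y)\<close>, which stay inside \<open>L\<close>;
  otherwise count the pairs \<open>(y, z)\<close>, which stay inside \<open>Y - L\<close> or lead to \<open>X - Y\<close>.  Half of the pairs
  inside \<open>Y\<close>, namely those between its two halves, are never counted.
\<close>

lemma card_middle_in_initial_segment:
  assumes "X \<subseteq> A" "Y \<subseteq> X" and initial: "\<And>y w. y \<in> Y \<Longrightarrow> w \<in> X - Y \<Longrightarrow> y < w"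
    and V: "V \<subseteq> T" "\<And>x y z. (x, y, z) \<in> V \<Longrightarrow> x \<in> X \<and> y \<in> Y \<and> z \<in> X"
  shows "real (card V) \<le> (real (card Y) - 1)^2 / 4 + (real (card Y) + 1) / 2 * real (card (X - Y))"
proof -
  have fin: "finite X" "finite Y" "finite V"
    using assms finite_ground finite_triples by (auto intro: finite_subset)
  define k where "k = card Y div 2"
  obtain L where L: "L \<subseteq> Y" "card L = k" "\<And>x y. x \<in> L \<Longrightarrow> y \<in> Y - L \<Longrightarrow> x < y"
    using initial_segment_exists[of Y k] fin by (auto simp: k_def)
  define U where "U = Y - L"
  have finL: "finite L" "finite U" using L fin by (auto simp: U_def intro: finite_subset)
  have cU: "card U = card Y - k" using L fin by (simp add: U_def card_Diff_subset finL)
  let ?V1 = "{(x, y, z) \<in> V. y \<in> L}" 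
  let ?V2 = "{(x, y, z) \<in> V. y \<in> U \<and> z \<in> U}" 
  let ?V3 = "{(x, y, z) \<in> V. y \<in> U \<and> z \<in> X - Y}"
  have V1: "card ?V1 \<le> card {(x, y). x \<in> L \<and> y \<in> L \<and> x < y}"
  proof (rule card_le_by_xy)
    fix x y z assume *: "(x, y, z) \<in> ?V1"
    then have "x < y" "x \<in> X" "y \<in> L" using V increasing by auto
    moreover have "x \<in> L" using calculation initial L by (metis DiffI order.asym subsetD)
    ultimately show "(x, y) \<in> {(x, y). x \<in> L \<and> y \<in> L \<and> x < y}" by simp
  qed (use V card_ordered_pairs[OF finL(1)] in auto)
  have V2: "card ?V2 \<le> card {(y, z). y \<in> U \<and> z \<in> U \<and> y < z}"
    by (rule card_le_by_yz) (use V card_ordered_pairs[OF finL(2)] increasing in auto)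
  have V3: "card ?V3 \<le> card (U \<times> (X - Y))"
    by (rule card_le_by_yz) (use V fin finL in auto)
  have sub: "V \<subseteq> ?V1 \<union> (?V2 \<union> ?V3)"
  proof
    fix t assume t: "t \<in> V"
    obtain x y z where xyz: "t = (x, y, z)" by (cases t)
    then have "y < z" "y \<in> Y" "z \<in> X" using t V increasing by blast+
    then have "z \<notin> L" if "y \<notin> L" using that L(3) by force
    then show "t \<in> ?V1 \<union> (?V2 \<union> ?V3)" using t xyz \<open>y \<in> Y\<close> \<open>z \<in> X\<close> by (auto simp: U_def)
  qed
  have "card V \<le> card (?V1 \<union> (?V2 \<union> ?V3))"
    by (rule card_mono[OF _ sub], rule finite_subset[OF _ fin(3)]) auto
  also have "\<dots> \<le> card ?V1 + (card ?V2 + card ?V3)"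
    using card_Un_le[of ?V1 "?V2 \<union> ?V3"] card_Un_le[of ?V2 ?V3] by linarith
  finally have "real (card V) \<le> real (card L) * (real (card L) - 1) / 2
      + real (card U) * (real (card U) - 1) / 2 + real (card U) * real (card (X - Y))"
    using V1 V2 V3 card_ordered_pairs(2)[OF finL(1)] card_ordered_pairs(2)[OF finL(2)]
    by (simp add: card_cartesian_product flip: of_nat_mult)
  moreover have "real (card L) * (real (card L) - 1) / 2 + real (card U) * (real (card U) - 1) / 2
      \<le> (real (card Y) - 1)^2 / 4 \<and> real (card U) \<le> (real (card Y) + 1) / 2"
  proof (cases "even (card Y)")
    case True
    then obtain j where "card Y = 2 * j" by auto
    then show ?thesis using L cU by (simp add: k_def power2_eq_square field_simps)
  next
    case False
    then obtain j where "card Y = 2 * j + 1" by (auto elim: oddE)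
    then show ?thesis using L cU by (simp add: k_def power2_eq_square field_simps)
  qed
  moreover have "real (card U) * real (card (X - Y)) \<le> (real (card Y) + 1) / 2 * real (card (X - Y))"
    using calculation(2) by (intro mult_right_mono) auto
  ultimately show ?thesis by linarith
qed

text \<open>
  The triples with \<open>y\<close> and \<open>z\<close> on different sides of \<open>S\<close> are counted by \<open>x \<in> R\<close> together with whichever of
  \<open>y\<close>, \<open>z\<close> is outside \<open>S\<close>, instead of by the pair \<open>(y, z)\<close>; for small \<open>R\<close> this saves almost the
  whole product \<open>|H \<inter> S| |H - S|\<close> of mixed pairs.
\<close>

lemma card_middle_above_le:
  assumes "H \<subseteq> A" and up: "\<And>y z. y \<in> H \<Longrightarrow> z \<in> A \<Longrightarrow> y < z \<Longrightarrow> z \<in> H"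
    and "R \<subseteq> A"
    and crossing: "\<And>x y z. (x, y, z) \<in> T \<Longrightarrow> (y \<in> S) \<noteq> (z \<in> S) \<Longrightarrow> x \<in> R"
  shows "real (card {(x, y, z) \<in> T. y \<in> H}) \<le>
      real (card (H \<inter> S)) * (real (card (H \<inter> S)) - 1) / 2
    + real (card (H - S)) * (real (card (H - S)) - 1) / 2
    + 2 * real (card R) * real (card (H - S))"
proof -
  have fin: "finite (H \<inter> S)" "finite (H - S)" "finite R" "finite T"
    using assms finite_ground finite_triples by (auto intro: finite_subset)
  let ?V = "\<lambda>p q. {(x, y, z) \<in> T. y \<in> H \<and> z \<in> H \<and> (y \<in> S) = p \<and> (z \<in> S) = q}"
  have "card (?V True True) \<le> card {(y, z). y \<in> H \<inter> S \<and> z \<in> H \<inter> S \<and> y < z}"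
    by (rule card_le_by_yz) (use card_ordered_pairs(1)[OF fin(1)] increasing in auto)
  moreover have "card (?V False False) \<le> card {(y, z). y \<in> H - S \<and> z \<in> H - S \<and> y < z}"
    by (rule card_le_by_yz) (use card_ordered_pairs(1)[OF fin(2)] increasing in auto)
  moreover have "card (?V False True) \<le> card (R \<times> (H - S))"
    by (rule card_le_by_xy) (use fin crossing in auto)
  moreover have "card (?V True False) \<le> card (R \<times> (H - S))"
    by (rule card_le_by_xz) (use fin crossing in auto)
  moreover have "card {(x, y, z) \<in> T. y \<in> H}
      \<le> card ((?V True True \<union> ?V False False) \<union> (?V False True \<union> ?V True False))"
  proof (rule card_mono)
    show "{(x, y, z) \<in> T. y \<in> H} \<subseteq> (?V True True \<union> ?V False False) \<union> (?V False True \<union> ?V True False)"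
      using up triples_in increasing by blast
    show "finite ((?V True True \<union> ?V False False) \<union> (?V False True \<union> ?V True False))"
      by (rule finite_subset[OF _ fin(4)]) auto
  qed
  moreover have "card ((?V True True \<union> ?V False False) \<union> (?V False True \<union> ?V True False))
      \<le> (card (?V True True) + card (?V False False)) + (card (?V False True) + card (?V True False))"
    by (intro order.trans[OF card_Un_le] add_mono card_Un_le)
  ultimately have "real (card {(x, y, z) \<in> T. y \<in> H})
      \<le> real (card {(y, z). y \<in> H \<inter> S \<and> z \<in> H \<inter> S \<and> y < z})
        + real (card {(y, z). y \<in> H - S \<and> z \<in> H - S \<and> y < z}) + 2 * real (card (R \<times> (H - S)))"
    by linarith
  then show ?thesis
    unfolding card_ordered_pairs(2)[OF fin(1)] card_ordered_pairs(2)[OF fin(2)]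
    by (simp add: card_cartesian_product)
qed

text \<open>
  Triples are counted by \<open>(x, y)\<close>, with two exceptions.  Those with \<open>x, y \<in> D\<close> lie entirely in \<open>D\<close>, and
  the preceding bound for initial segments applies to them.  Those with \<open>x \<in> R\<close>, \<open>y \<in> S\<close> can be
  counted by \<open>(x, z)\<close> with \<open>z \<notin> S\<close>, and those with \<open>x \<in> S\<close>, \<open>y \<in> R\<close> by \<open>(y, z)\<close> with \<open>z \<in> R\<close>; this is
  cheaper than \<open>|H \<inter> R| |H \<inter> S|\<close> when \<open>A - S\<close> is small, which explains the minimum.
\<close>

lemma card_middle_below_le:
  assumes A: "A = S \<union> D \<union> R" "S \<inter> D = {}" "S \<inter> R = {}" "D \<inter> R = {}"
    and "H \<subseteq> A" and down: "\<And>x y. x \<in> H \<Longrightarrow> y \<in> A - H \<Longrightarrow> x < y"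
    and RS: "\<And>x y z. (x, y, z) \<in> T \<Longrightarrow> x \<in> R \<Longrightarrow> y \<in> S \<Longrightarrow> z \<notin> S"
    and SR: "\<And>x y z. (x, y, z) \<in> T \<Longrightarrow> x \<in> S \<Longrightarrow> y \<in> R \<Longrightarrow> z \<in> R"
    and DD: "\<And>x y z. (x, y, z) \<in> T \<Longrightarrow> x \<in> D \<Longrightarrow> y \<in> D \<Longrightarrow> z \<in> D"
  shows "real (card {(x, y, z) \<in> T. y \<in> H}) \<le>
      real (card (H \<inter> S)) * (real (card (H \<inter> S)) - 1) / 2
    + real (card (H \<inter> R)) * (real (card (H \<inter> R)) - 1) / 2
    + real (card (H \<inter> D)) * (real (card (H \<inter> S)) + real (card (H \<inter> R)))
    + ((real (card (H \<inter> D)) - 1)^2 / 4 + (real (card (H \<inter> D)) + 1) / 2 * real (card (D - H)))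
    + real (card (H \<inter> R)) * min (real (card (H \<inter> S))) (real (card (A - S)) + real (card R))"
proof -
  have fin: "finite (H \<inter> S)" "finite (H \<inter> R)" "finite (H \<inter> D)" "finite R" "finite (A - S)" "finite T"
    using assms finite_ground finite_triples by (auto intro: finite_subset)
  have xH: "x \<in> H \<and> x < y" if "(x, y, z) \<in> T" "y \<in> H" for x y z
    using that down[of y x] increasing triples_in by (metis DiffI order.asym)
  let ?V = "\<lambda>X Y. {(x, y, z) \<in> T. y \<in> H \<and> x \<in> X \<and> y \<in> Y}"
  let ?VD = "{(x, y, z) \<in> T. y \<in> H \<and> (x \<in> D \<and> y \<in> S \<union> R \<or> x \<in> S \<union> R \<and> y \<in> D)}"
  let ?M = "{(x, y). x < y \<and> (x \<in> H \<inter> R \<and> y \<in> H \<inter> S \<or> x \<in> H \<inter> S \<and> y \<in> H \<inter> R)}"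
  let ?N = "{(x, y). x < y \<and> (x \<in> H \<inter> D \<and> y \<in> H \<inter> (S \<union> R) \<or> x \<in> H \<inter> (S \<union> R) \<and> y \<in> H \<inter> D)}"
  have SS: "card (?V S S) \<le> card {(x, y). x \<in> H \<inter> S \<and> y \<in> H \<inter> S \<and> x < y}"
    by (rule card_le_by_xy) (use card_ordered_pairs(1)[OF fin(1)] xH in auto)
  have RR: "card (?V R R) \<le> card {(x, y). x \<in> H \<inter> R \<and> y \<in> H \<inter> R \<and> x < y}"
    by (rule card_le_by_xy) (use card_ordered_pairs(1)[OF fin(2)] xH in auto)
  have finSR: "finite (H \<inter> (S \<union> R))" using fin by (simp add: Int_Un_distrib)
  have "card ?VD \<le> card ?N"
    by (rule card_le_by_xy) (use card_mixed_pairs_le(1)[OF fin(3) finSR] xH in auto)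
  also have "\<dots> \<le> card (H \<inter> D) * card (H \<inter> (S \<union> R))"
    by (rule card_mixed_pairs_le(2)[OF fin(3) finSR]) (use A in auto)
  also have "card (H \<inter> (S \<union> R)) = card (H \<inter> S) + card (H \<inter> R)"
    unfolding Int_Un_distrib by (rule card_Un_disjoint) (use fin A in auto)
  finally have D': "card ?VD \<le> card (H \<inter> D) * (card (H \<inter> S) + card (H \<inter> R))" .
  have DD': "real (card (?V D D)) \<le> (real (card (H \<inter> D)) - 1)^2 / 4
      + (real (card (H \<inter> D)) + 1) / 2 * real (card (D - H \<inter> D))"
    by (rule card_middle_in_initial_segment) (use A DD down in auto)
  have "card (?V R S) \<le> card ((H \<inter> R) \<times> (A - S))"
    by (rule card_le_by_xz) (use fin RS xH triples_in in auto)
  moreover have "card (?V S R) \<le> card ((H \<inter> R) \<times> R)"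
    by (rule card_le_by_yz) (use fin SR in auto)
  moreover have "card (?V R S \<union> ?V S R) \<le> card (?V R S) + card (?V S R)"
    by (rule card_Un_le)
  ultimately have M1: "card (?V R S \<union> ?V S R) \<le> card (H \<inter> R) * (card (A - S) + card R)"
    by (simp add: card_cartesian_product algebra_simps)
  have "card (?V R S \<union> ?V S R) \<le> card ?M"
    by (rule card_le_by_xy) (use card_mixed_pairs_le(1)[OF fin(2) fin(1)] xH in auto)
  also have "\<dots> \<le> card (H \<inter> R) * card (H \<inter> S)"
    by (rule card_mixed_pairs_le(2)[OF fin(2) fin(1)]) (use A in auto)
  finally have M: "real (card (?V R S \<union> ?V S R))
      \<le> real (card (H \<inter> R)) * min (real (card (H \<inter> S))) (real (card (A - S)) + real (card R))"
    using M1 unfolding min_def by (simp flip: of_nat_mult of_nat_add)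
  have "card {(x, y, z) \<in> T. y \<in> H}
      \<le> card (?V S S \<union> (?V R R \<union> (?VD \<union> (?V D D \<union> (?V R S \<union> ?V S R)))))"
  proof (rule card_mono)
    show "{(x, y, z) \<in> T. y \<in> H} \<subseteq> ?V S S \<union> (?V R R \<union> (?VD \<union> (?V D D \<union> (?V R S \<union> ?V S R))))"
    proof
      fix t assume t: "t \<in> {(x, y, z) \<in> T. y \<in> H}"
      obtain x y z where xyz: "t = (x, y, z)" by (cases t)
      then have "x \<in> S \<union> D \<union> R" "y \<in> S \<union> D \<union> R" using t triples_in A(1) by blast+
      then show "t \<in> ?V S S \<union> (?V R R \<union> (?VD \<union> (?V D D \<union> (?V R S \<union> ?V S R))))"
        using t xyz by auto
    qed
    show "finite (?V S S \<union> (?V R R \<union> (?VD \<union> (?V D D \<union> (?V R S \<union> ?V S R)))))"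
      by (rule finite_subset[OF _ fin(6)]) auto
  qed
  also have "\<dots> \<le> card (?V S S) + (card (?V R R) + (card ?VD + (card (?V D D) + card (?V R S \<union> ?V S R))))"
    by (intro order.trans[OF card_Un_le] add_mono order.refl card_Un_le)
  finally have "real (card {(x, y, z) \<in> T. y \<in> H}) \<le> real (card (?V S S)) + real (card (?V R R))
      + real (card ?VD) + real (card (?V D D)) + real (card (?V R S \<union> ?V S R))"
    by linarith
  moreover have "D - H \<inter> D = D - H" by auto
  moreover have "real (card ?VD) \<le> real (card (H \<inter> D)) * (real (card (H \<inter> S)) + real (card (H \<inter> R)))"
    using D' by (simp flip: of_nat_mult of_nat_add)
  moreover have "real (card (?V S S)) \<le> real (card (H \<inter> S)) * (real (card (H \<inter> S)) - 1) / 2"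
    using SS card_ordered_pairs(2)[OF fin(1)] by linarith
  moreover have "real (card (?V R R)) \<le> real (card (H \<inter> R)) * (real (card (H \<inter> R)) - 1) / 2"
    using RR card_ordered_pairs(2)[OF fin(2)] by linarith
  ultimately show ?thesis using DD' M by simp
qed

end

section \<open>Numerical estimates\<close>

text \<open>
  If all weights are below \<open>\<alpha>\<close>, adding them one by one cannot jump over the interval
  from \<open>\<alpha>\<close> to \<open>2 \<alpha>\<close>.
\<close>

lemma subset_sum_between:
  fixes f :: "'i \<Rightarrow> real"
  assumes "finite I" "\<And>i. i \<in> I \<Longrightarrow> 0 \<le> f i" "0 < \<alpha>" "2 * \<alpha> \<le> \<beta>" "\<alpha> \<le> sum f I"
  obtains J where "J \<subseteq> I" "\<alpha> \<le> sum f J" "sum f J \<le> \<beta>" | i where "i \<in> I" "\<beta> < f i"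
proof (cases "\<exists>i\<in>I. \<alpha> \<le> f i")
  case True
  then obtain i where i: "i \<in> I" "\<alpha> \<le> f i" by blast
  show thesis
  proof (cases "f i \<le> \<beta>")
    case True
    then show thesis using i by (intro that(1)[of "{i}"]) auto
  qed (use i that in auto)
next
  case False
  have "\<exists>J\<subseteq>I. \<alpha> \<le> sum f J \<and> sum f J \<le> 2 * \<alpha>"
    using assms(1,2,5) False
  proof (induction I rule: finite_induct)
    case empty
    then show ?case using \<open>0 < \<alpha>\<close> by simp
  next
    case (insert i I)
    show ?case
    proof (cases "\<alpha> \<le> sum f I")
      case True
      then show ?thesis using insert.IH insert.prems by (meson insertCI subset_insertI2)
    next
      case False
      then have "sum f (insert i I) \<le> 2 * \<alpha>" using insert by force
      then show ?thesis using insert.prems by blast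
    qed
  qed
  then show thesis using that(1) assms(4) by (meson order.trans)
qed

lemma halves_bound:
  fixes n l u :: real
  assumes "l + u = n" "n / 2 \<le> u" "u \<le> (n + 1) / 2"
  shows "l * (l - 1) / 2 + u * (u - 1) / 2 \<le> n^2 / 4 - n / 2 + 1 / 4"
proof -
  have "(u - n / 2)^2 \<le> (1 / 2)^2" using assms by (intro power_mono) (auto simp: field_simps)
  moreover have l: "l = n - u" using assms by simp
  ultimately show ?thesis unfolding l by (simp add: power2_eq_square field_simps)
qed

text \<open>
  Here \<open>s\<close> and \<open>b\<close> are the numbers of points of the upper half inside and outside \<open>S\<close>, and \<open>\<rho> = |R|\<close>.
  At least \<open>b (s - 2 \<rho>)\<close> pairs are wasted.  The concave function \<open>(n / 2 - s) (s - n / 5)\<close> takes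
  the value \<open>0.0029 n\<^sup>2\<close> at both \<open>s = 0.21 n\<close> and \<open>s = 0.49 n\<close>.
\<close>

lemma balanced_cut_bound:
  fixes n l u s b \<rho> :: real
  assumes "l + u = n" "n / 2 \<le> u" "u \<le> (n + 1) / 2" "s + b = u" "1 \<le> n"
    and "21 / 100 * n \<le> s" "s \<le> 49 / 100 * n" "\<rho> \<le> n / 10"
  shows "l * (l - 1) / 2 + 1 / 4 + (s * (s - 1) / 2 + b * (b - 1) / 2 + 2 * \<rho> * b)
     \<le> 99 / 400 * n^2 + (n - 1)"
proof -
  have eq: "s * (s - 1) / 2 + b * (b - 1) / 2 = u * (u - 1) / 2 - s * b"
    unfolding assms(4)[symmetric] by (simp add: field_simps)
  have "0 \<le> (s - 21 / 100 * n) * (49 / 100 * n - s)" using assms by simp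
  then have "29 / 10000 * n^2 \<le> (n / 2 - s) * (s - n / 5)"
    by (simp add: power2_eq_square field_simps)
  also have "\<dots> \<le> b * (s - n / 5)" using assms by (intro mult_right_mono) auto
  also have "\<dots> \<le> b * (s - 2 * \<rho>)" using assms by (intro mult_left_mono) auto
  finally have "29 / 10000 * n^2 \<le> s * b - 2 * \<rho> * b" by (simp add: algebra_simps)
  then show ?thesis using eq halves_bound[OF assms(1-3)] assms(5) zero_le_power2[of n] by linarith
qed

text \<open>
  The upper half has \<open>s\<close> points in \<open>S\<close> and \<open>h\<close> outside; the lower half has \<open>p\<close>, \<open>e\<close>, \<open>r\<close> points in \<open>S\<close>, \<open>D\<close>,
  \<open>R\<close>; \<open>\<rho> = |R|\<close>, \<open>\<beta> = |A - S|\<close>, and \<open>\<delta>\<close> counts the points of \<open>D\<close> in the upper half.  Up to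
  lower order terms, at least \<open>gain\<close> pairs are wasted.  If \<open>e \<ge> n / 10\<close>, its term \<open>e\<^sup>2 / 4\<close> is enough.  If \<open>e < n / 10\<close>, the
  deficit of \<open>e\<^sup>2 / 4\<close> is at most linear in \<open>n / 10 - e \<le> r + h\<close>, and the terms linear in \<open>r\<close> and in \<open>h\<close>
  outweigh it.
\<close>

lemma dominant_class_bound:
  fixes n l u s h p e r \<rho> \<delta> \<beta> :: real
  assumes "l + u = n" "n / 2 \<le> u" "u \<le> (n + 1) / 2" "s + h = u" "p + e + r = l" "2 \<le> n"
    and nonneg: "0 \<le> h" "0 \<le> p" "0 \<le> e" "0 \<le> r"
    and s: "49 / 100 * n < s" and \<rho>: "\<rho> \<le> n / 10" "r \<le> \<rho>" "\<rho> \<le> r + h" and \<delta>: "\<delta> \<le> h"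
    and \<beta>: "\<beta> = e + r + h" "n / 10 \<le> \<beta>"
  shows "p * (p - 1) / 2 + r * (r - 1) / 2 + e * (p + r) + ((e - 1)^2 / 4 + (e + 1) / 2 * \<delta>)
       + r * min p (\<beta> + \<rho>) + (s * (s - 1) / 2 + h * (h - 1) / 2 + 2 * \<rho> * h)
     \<le> 99 / 400 * n^2 + (n - 1)" (is "?lhs \<le> _")
proof -
  define gain where "gain = e^2 / 4 - (e + 1) / 2 * h + h * (s - 2 * \<rho>) + r * (p - min p (\<beta> + \<rho>))"
  have "(e + 1) / 2 * \<delta> \<le> (e + 1) / 2 * h" using nonneg \<delta> by (intro mult_left_mono) auto
  moreover have "p * (p - 1) / 2 + r * (r - 1) / 2 + e * (p + r) + (e - 1)^2 / 4
      = l * (l - 1) / 2 - p * r - e^2 / 4 + 1 / 4"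
    unfolding assms(5)[symmetric] by (simp add: power2_eq_square field_simps)
  moreover have "s * (s - 1) / 2 + h * (h - 1) / 2 = u * (u - 1) / 2 - s * h"
    unfolding assms(4)[symmetric] by (simp add: field_simps)
  moreover have "h * (s - 2 * \<rho>) = s * h - 2 * \<rho> * h"
    "r * (p - min p (\<beta> + \<rho>)) = p * r - r * min p (\<beta> + \<rho>)"
    by (simp_all add: algebra_simps)
  ultimately have "?lhs \<le> l * (l - 1) / 2 + u * (u - 1) / 2 + 1 / 4 - gain"
    unfolding gain_def by linarith
  then have lhs: "?lhs \<le> n^2 / 4 - n / 2 + 1 / 2 - gain"
    using halves_bound[OF assms(1-3)] by linarith
  have h_le: "h \<le> (n + 1) / 2 - 49 / 100 * n" and e_le: "e \<le> n / 2" using assms by linarith+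
  have upper: "h * (29 / 100 * n) \<le> h * (s - 2 * \<rho>)"
    using assms by (intro mult_left_mono) auto
  have "n^2 / 400 - 3 / 2 * n + 3 / 2 \<le> gain"
  proof (cases "n / 10 \<le> e")
    case True
    then have "(n / 10)^2 \<le> e^2" using assms by (intro power_mono) auto
    then have "n^2 / 400 \<le> e^2 / 4" by (simp add: power2_eq_square)
    moreover have "(e + 1) / 2 * h \<le> (n / 4 + 1 / 2) * h"
      using e_le nonneg by (intro mult_right_mono) auto
    moreover have "0 \<le> r * (p - min p (\<beta> + \<rho>))" using nonneg by (intro mult_nonneg_nonneg) auto
    moreover have "0 \<le> h * n" using nonneg assms by simp
    ultimately show ?thesis using upper h_le \<open>2 \<le> n\<close> unfolding gain_def by (simp add: algebra_simps add_divide_distrib)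
  next
    case False
    have eh: "e * h \<le> n / 10 * h" using False nonneg by (intro mult_right_mono) auto
    have "p - min p (\<beta> + \<rho>) \<ge> n / 2 - 1 / 2 - 2 * e - 3 * r - 2 * h"
      using assms by (simp add: min_def field_simps)
    then have low: "r * (n / 2 - 1 / 2 - 2 * e - 3 * r - 2 * h) \<le> r * (p - min p (\<beta> + \<rho>))"
      using nonneg by (intro mult_left_mono) auto
    have r_le: "r \<le> n / 10" using \<rho> by simp
    \<comment> \<open>\<open>e\<^sup>2 / 4 - 2 r e\<close> decreases in \<open>e\<close> up to \<open>4 r\<close>; for \<open>4 r \<ge> n / 10\<close> it is smallest at \<open>e = n / 10\<close>.\<close>
    show ?thesis
    proof (cases "n / 40 \<le> r")
      case True
      have "0 \<le> (n / 10 - e) * (2 * r - (e + n / 10) / 4)"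
        using False True by (intro mult_nonneg_nonneg) auto
      then have "n^2 / 400 - n / 10 * (2 * r) \<le> e^2 / 4 - e * (2 * r)"
        by (simp add: power2_eq_square field_simps)
      moreover have "0 \<le> r * (3 / 10 * n - 3 * r)"
        using r_le nonneg by (intro mult_nonneg_nonneg) auto
      moreover have "r * h \<le> n / 10 * h" using r_le nonneg by (intro mult_right_mono)
      moreover have "0 \<le> n * h" using nonneg \<open>2 \<le> n\<close> by simp
      ultimately show ?thesis using upper low eh h_le r_le \<open>2 \<le> n\<close>
        unfolding gain_def by (simp add: algebra_simps power2_eq_square add_divide_distrib)
    next
      case rsmall: False
      define w where "w = n / 10 - e"
      have w: "w \<le> r + h" using \<beta> by (simp add: w_def)
      have "n^2 / 400 - n / 20 * w \<le> e^2 / 4"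
      proof -
        have "n^2 / 400 - n / 20 * w = e^2 / 4 - w^2 / 4"
          unfolding w_def by (simp add: power2_eq_square field_simps)
        then show ?thesis using zero_le_power2[of w] by linarith
      qed
      moreover have "n / 20 * w \<le> n / 20 * (r + h)" using w assms by (intro mult_left_mono) auto
      moreover have "0 \<le> r * (11 / 40 * n - (2 * e + 3 * r))"
        using rsmall False nonneg by (intro mult_nonneg_nonneg) auto
      moreover have "r * h \<le> n / 40 * h" using rsmall nonneg by (intro mult_right_mono) auto
      moreover have "0 \<le> n * h" "0 \<le> r * n" using nonneg \<open>2 \<le> n\<close> by simp_all
      ultimately show ?thesis using upper low eh h_le r_le \<open>2 \<le> n\<close>
        unfolding gain_def by (simp add: algebra_simps power2_eq_square add_divide_distrib)
    qed
  qed
  then show ?thesis using lhs by (simp add: field_simps)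
qed


section \<open>Residues of the points of a triple\<close>

definition triples :: "int \<Rightarrow> int \<Rightarrow> int set \<Rightarrow> (int \<times> int \<times> int) set" where
  "triples a c A = {(x, y, z). x \<in> A \<and> y \<in> A \<and> z \<in> A \<and> (\<exists>d>0. y = x + a * d \<and> z = y + c * d)}"

lemma pair_determined_triples_triples:
  assumes "0 < a" "0 < c" "finite A"
  shows "pair_determined_triples (triples a c A) A"
proof
  show "x = x'" if "(x, y, z) \<in> triples a c A" "(x', y, z) \<in> triples a c A" for x x' y z
    using that assms by (auto simp: triples_def)
  show "z = z'" if "(x, y, z) \<in> triples a c A" "(x, y, z') \<in> triples a c A" for x y z z'
    using that assms by (auto simp: triples_def)
  show "y = y'" if "(x, y, z) \<in> triples a c A" "(x, y', z) \<in> triples a c A" for x y y' z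
  proof -
    from that obtain d d' where d: "y = x + a * d" "z = y + c * d" "y' = x + a * d'" "z = y' + c * d'"
      unfolding triples_def by blast
    then have "(a + c) * d = (a + c) * d'" by (simp add: algebra_simps)
    then show ?thesis using d assms by simp
  qed
qed (use assms in \<open>auto simp: triples_def\<close>)

text \<open>
  The differences are \<open>a d\<close>, \<open>c d\<close> and \<open>(a + c) d\<close>, so each of the three congruences says that \<open>m\<close> divides \<open>d\<close>.
\<close>

lemma triples_residues:
  fixes a c m :: int
  assumes "(x, y, z) \<in> triples a c A" "coprime a m" "coprime (a + c) m" "c \<noteq> 0"
  shows "x mod m = y mod m \<longleftrightarrow> y mod (c * m) = z mod (c * m)"
    and "x mod m = z mod m \<longleftrightarrow> y mod (c * m) = z mod (c * m)"
proof -
  from assms(1) obtain d where "y = x + a * d" "z = y + c * d" unfolding triples_def by blast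
  then have d: "y - x = a * d" "z - y = c * d" "z - x = (a + c) * d" by (simp_all add: algebra_simps)
  have "y mod (c * m) = z mod (c * m) \<longleftrightarrow> m dvd d"
    using d assms(4) by (metis mod_eq_dvd_iff dvd_mult_cancel_left)
  moreover have "x mod m = y mod m \<longleftrightarrow> m dvd d"
    using d assms(2) by (metis mod_eq_dvd_iff coprime_commute coprime_dvd_mult_right_iff)
  moreover have "x mod m = z mod m \<longleftrightarrow> m dvd d"
    using d assms(3) by (metis mod_eq_dvd_iff coprime_commute coprime_dvd_mult_right_iff)
  ultimately show "x mod m = y mod m \<longleftrightarrow> y mod (c * m) = z mod (c * m)"
    and "x mod m = z mod m \<longleftrightarrow> y mod (c * m) = z mod (c * m)" by blast+
qed

lemma residues_separate:
  fixes A :: "int set"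
  assumes "finite A" "2 \<le> c"
  obtains k where "\<And>x y. x \<in> A \<Longrightarrow> y \<in> A \<Longrightarrow> x mod c ^ k = y mod c ^ k \<Longrightarrow> x = y"
proof -
  define N where "N = (\<Sum>x\<in>A. \<bar>x\<bar>)"
  define k where "k = nat (2 * N + 1)"
  have N: "\<bar>x\<bar> \<le> N" if "x \<in> A" for x
    unfolding N_def using that assms(1) by (intro member_le_sum) auto
  have "int k < 2 ^ k" using less_exp[of k] by (simp flip: of_nat_less_iff)
  also have "(2::int) ^ k \<le> c ^ k" using assms(2) by (intro power_mono) auto
  finally have big: "2 * N < c ^ k" using N by (simp add: k_def split: if_splits)
  show thesis
  proof (rule that[of k])
    fix x y assume xy: "x \<in> A" "y \<in> A" "x mod c ^ k = y mod c ^ k"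
    then have "c ^ k dvd x - y" by (simp add: mod_eq_dvd_iff)
    moreover have "\<bar>x - y\<bar> < c ^ k" using N[OF xy(1)] N[OF xy(2)] big by linarith
    ultimately show "x = y" using zdvd_not_zless[of "\<bar>x - y\<bar>" "c ^ k"] by auto
  qed
qed

text \<open>
  Modulo \<open>c ^ 0\<close> all of \<open>A\<close> is one class, and modulo a high power the classes are singletons; stop
  just before the first exponent at which every class has at most \<open>\<theta>\<close> points.
\<close>

lemma large_class_with_small_subclasses:
  fixes A :: "int set" and \<theta> :: real
  assumes "finite A" "2 \<le> c" "1 \<le> \<theta>" "\<theta> < real (card A)"
  obtains k q where "\<theta> < real (card {x \<in> A. x mod c ^ k = q})"
    and "\<And>q. real (card {x \<in> A. x mod (c * c ^ k) = q}) \<le> \<theta>"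
proof -
  define small where "small k \<longleftrightarrow> (\<forall>q. real (card {x \<in> A. x mod c ^ k = q}) \<le> \<theta>)" for k
  have "\<not> small 0"
  proof -
    have "{x \<in> A. x mod c ^ 0 = 0} = A" by auto
    then show ?thesis using assms(4) unfolding small_def by (metis not_le)
  qed
  moreover have "\<exists>k. small k"
  proof -
    obtain k where k: "\<And>x y. x \<in> A \<Longrightarrow> y \<in> A \<Longrightarrow> x mod c ^ k = y mod c ^ k \<Longrightarrow> x = y"
      using residues_separate[OF assms(1,2)] by blast
    have "card {x \<in> A. x mod c ^ k = q} \<le> 1" for q
      by (subst card_le_Suc0_iff_eq[unfolded One_nat_def[symmetric]]) (use assms(1) k in auto)
    then have "real (card {x \<in> A. x mod c ^ k = q}) \<le> \<theta>" for q
      using assms(3) by (meson of_nat_le_1_iff order.trans)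
    then show ?thesis unfolding small_def by blast
  qed
  ultimately obtain k where "\<not> small k" "small (Suc k)"
    by (metis LeastI_ex Least_le not0_implies_Suc Suc_n_not_le_n)
  then show thesis using that by (auto simp: small_def not_le)
qed

section \<open>The bound for one set\<close>

lemma card_triples_le:
  assumes "0 < a" "2 \<le> c" "coprime a c" "finite A" "A \<noteq> {}"
  shows "real (card (triples a c A)) \<le> 99 / 400 * real (card A)^2 + (real (card A) - 1)"
proof -
  interpret pair_determined_triples "triples a c A" A
    by (rule pair_determined_triples_triples) (use assms in auto)
  define n where "n = real (card A)"
  have "1 \<le> n" using assms by (simp add: n_def Suc_le_eq card_gt_0_iff)
  show ?thesis
  proof (cases "2 \<le> card A")
    case False
    have "real (card (triples a c A)) \<le> (real (card A) - 1)^2 / 4 + (real (card A) + 1) / 2 * real (card (A - A))"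
      by (rule card_middle_in_initial_segment) (use triples_in in auto)
    moreover have "card A = 1" using False \<open>1 \<le> n\<close> by (simp add: n_def)
    ultimately show ?thesis by simp
  next
    case True
    then have n2: "2 \<le> n" by (simp add: n_def)
    obtain k q where k: "9 / 10 * n < real (card {x \<in> A. x mod c ^ k = q})"
      and small: "\<And>s. real (card {x \<in> A. x mod (c * c ^ k) = s}) \<le> 9 / 10 * n"
      by (rule large_class_with_small_subclasses[OF assms(4,2), of "9 / 10 * n"])
        (use n2 in \<open>auto simp: n_def\<close>)
    define m where "m = c ^ k"
    define Q where "Q = {x \<in> A. x mod m = q}"
    define R where "R = A - Q"
    have Q: "9 / 10 * n < real (card Q)" using k by (simp add: Q_def m_def)
    have "coprime (a + c) c" using assms(3) by (metis coprime_iff_gcd_eq_1 gcd_add1)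
    then have cop: "coprime a m" "coprime (a + c) m" "c \<noteq> 0" using assms by (auto simp: m_def)
    note res = triples_residues[OF _ cop]
    have "Q \<subseteq> A" by (auto simp: Q_def)
    then have fin: "finite A" "finite Q" "finite R" using assms by (auto simp: R_def intro: finite_subset)
    have cR: "real (card R) = n - real (card Q)"
      using card_Diff_subset[of Q A] \<open>Q \<subseteq> A\<close> fin card_mono[of A Q] by (simp add: R_def n_def)
    \<comment> \<open>\<open>Q\<close> is a union of classes modulo \<open>c m\<close>.\<close>
    have same: "(y \<in> Q) = (z \<in> Q)" if "y \<in> A" "z \<in> A" "y mod (c * m) = z mod (c * m)" for y z
      using that by (metis (mono_tags, lifting) Q_def mem_Collect_eq mod_mult_self2_is_0 mod_mod_cancel dvd_triv_right)
    obtain L where L: "L \<subseteq> A" "card L = card A div 2" "\<And>x y. x \<in> L \<Longrightarrow> y \<in> A - L \<Longrightarrow> x < y"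
      using initial_segment_exists[of A "card A div 2"] fin by auto
    define U where "U = A - L"
    have finLU: "finite L" "finite U" using L fin by (auto simp: U_def intro: finite_subset)
    have cU: "card U = card A - card A div 2"
      using L finLU by (simp add: U_def card_Diff_subset)
    have cLU: "real (card L) + real (card U) = n" "n / 2 \<le> real (card U)" "real (card U) \<le> (n + 1) / 2"
    proof -
      have "card L + card U = card A" "card A \<le> 2 * card U" "2 * card U \<le> card A + 1"
        unfolding cU L(2) by linarith+
      then show "real (card L) + real (card U) = n" "n / 2 \<le> real (card U)"
        "real (card U) \<le> (n + 1) / 2"
        by (simp_all add: n_def field_simps flip: of_nat_add of_nat_mult of_nat_Suc)
    qed
    have split: "real (card (triples a c A)) \<le> real (card {(x, y, z) \<in> triples a c A. y \<in> L})
        + real (card {(x, y, z) \<in> triples a c A. y \<in> U})"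
    proof -
      let ?V = "\<lambda>X. {(x, y, z) \<in> triples a c A. y \<in> X}"
      have "card (triples a c A) = card (?V L \<union> ?V U)"
        by (rule arg_cong[of _ _ card]) (use triples_in in \<open>auto simp: U_def\<close>)
      then show ?thesis using card_Un_le[of "?V L" "?V U"] by linarith
    qed
    have upper: "real (card {(x, y, z) \<in> triples a c A. y \<in> U}) \<le>
        real (card (U \<inter> S)) * (real (card (U \<inter> S)) - 1) / 2
      + real (card (U - S)) * (real (card (U - S)) - 1) / 2 + 2 * real (card R) * real (card (U - S))"
      if S: "S = {x \<in> Q. x mod (c * m) \<in> J}" for S J
    proof (rule card_middle_above_le)
      show "z \<in> U" if "y \<in> U" "z \<in> A" "y < z" for y z
        using that L(3)[of z y] by (force simp: U_def)
      show "x \<in> R" if t: "(x, y, z) \<in> triples a c A" and yz: "(y \<in> S) \<noteq> (z \<in> S)" for x y z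
      proof (rule ccontr)
        have xyz: "x \<in> A" "y \<in> A" "z \<in> A" using triples_in[OF t] by auto
        assume "x \<notin> R"
        then have "x \<in> Q" using xyz by (simp add: R_def)
        have "y mod (c * m) \<noteq> z mod (c * m)" using yz same[OF xyz(2,3)] S by auto
        then have "y \<notin> Q" "z \<notin> Q" using \<open>x \<in> Q\<close> res[OF t] by (auto simp: Q_def)
        then show False using yz S by simp
      qed
    qed (auto simp: U_def R_def)
    have cut: "real (card (U \<inter> S)) + real (card (U - S)) = real (card U)" for S
      using finLU card_Int_Diff[of U S] by simp
    \<comment> \<open>\<open>f s\<close> is the size of the subclass \<open>s\<close> of \<open>Q\<close> in the upper half.\<close>
    define f where "f s = real (card {x \<in> U \<inter> Q. x mod (c * m) = s})" for s
    define I where "I = (\<lambda>x. x mod (c * m)) ` (U \<inter> Q)"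
    have "finite I" using finLU by (simp add: I_def)
    have sum_f: "sum f J = real (card (U \<inter> {x \<in> Q. x mod (c * m) \<in> J}))" if "J \<subseteq> I" for J
    proof -
      have "finite J" using that \<open>finite I\<close> by (rule finite_subset)
      have "U \<inter> {x \<in> Q. x mod (c * m) \<in> J} = (\<Union>s\<in>J. {x \<in> U \<inter> Q. x mod (c * m) = s})" by auto
      moreover have "card (\<Union>s\<in>J. {x \<in> U \<inter> Q. x mod (c * m) = s})
          = (\<Sum>s\<in>J. card {x \<in> U \<inter> Q. x mod (c * m) = s})"
        by (rule card_UN_disjoint) (use finLU \<open>finite J\<close> in auto)
      ultimately show ?thesis by (simp add: f_def)
    qed
    have total: "21 / 100 * n \<le> sum f I"
    proof -
      have "U \<inter> {x \<in> Q. x mod (c * m) \<in> I} = U \<inter> Q" by (auto simp: I_def)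
      then have "sum f I = real (card (U \<inter> Q))" using sum_f[of I] by simp
      moreover have "card (U - Q) \<le> card R" by (rule card_mono) (use fin in \<open>auto simp: U_def R_def\<close>)
      ultimately show ?thesis using cut[of Q] cLU cR Q n2 by linarith
    qed
    show ?thesis
    proof (rule subset_sum_between[OF \<open>finite I\<close> _ _ _ total, where \<beta> = "49 / 100 * n"])
      fix J assume J: "J \<subseteq> I" "21 / 100 * n \<le> sum f J" "sum f J \<le> 49 / 100 * n"
      define S where "S = {x \<in> Q. x mod (c * m) \<in> J}"
      \<comment> \<open>The cut of the upper half suffices; in the lower half the trivial count is
        obtained by taking \<open>S = A\<close> and \<open>D = R = {}\<close>.\<close>
      have lower: "real (card {(x, y, z) \<in> triples a c A. y \<in> L})
          \<le> real (card (L \<inter> A)) * (real (card (L \<inter> A)) - 1) / 2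
          + real (card (L \<inter> {})) * (real (card (L \<inter> {})) - 1) / 2
          + real (card (L \<inter> {})) * (real (card (L \<inter> A)) + real (card (L \<inter> {})))
          + ((real (card (L \<inter> {})) - 1)^2 / 4 + (real (card (L \<inter> {})) + 1) / 2 * real (card ({} - L)))
          + real (card (L \<inter> {})) * min (real (card (L \<inter> A))) (real (card (A - A)) + real (card ({} :: int set)))"
        by (rule card_middle_below_le) (use L in auto)
      have "L \<inter> A = L" using L by auto
      then have "real (card {(x, y, z) \<in> triples a c A. y \<in> L})
          \<le> real (card L) * (real (card L) - 1) / 2 + 1 / 4" using lower by simp
      moreover have "real (card L) * (real (card L) - 1) / 2 + 1 / 4
          + (real (card (U \<inter> S)) * (real (card (U \<inter> S)) - 1) / 2
          + real (card (U - S)) * (real (card (U - S)) - 1) / 2 + 2 * real (card R) * real (card (U - S)))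
          \<le> 99 / 400 * n^2 + (n - 1)"
        by (rule balanced_cut_bound[OF cLU cut])
          (use J sum_f[OF J(1)] n2 cR Q in \<open>auto simp: S_def\<close>)
      ultimately show ?thesis using split upper[OF S_def] unfolding n_def by linarith
    next
      \<comment> \<open>One subclass dominates the upper half, and the lower half must contribute.\<close>
      fix s assume s: "s \<in> I" "49 / 100 * n < f s"
      define S where "S = {x \<in> Q. x mod (c * m) \<in> {s}}"
      define D where "D = Q - S"
      have parts: "A = S \<union> D \<union> R" "S \<inter> D = {}" "S \<inter> R = {}" "D \<inter> R = {}"
        using \<open>Q \<subseteq> A\<close> by (auto simp: S_def D_def R_def)
      have finS: "finite S" "finite D" using fin by (auto simp: S_def D_def)
      have "f s = real (card (U \<inter> S))" using sum_f[of "{s}"] s by (simp add: S_def)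
      then have big: "49 / 100 * n < real (card (U \<inter> S))" using s by simp
      have cS: "real (card S) \<le> 9 / 10 * n"
      proof -
        have "card S \<le> card {x \<in> A. x mod (c * c ^ k) = s}"
          by (rule card_mono) (use fin \<open>Q \<subseteq> A\<close> in \<open>auto simp: S_def m_def\<close>)
        then show ?thesis using small[of s] by linarith
      qed
      have lower: "real (card {(x, y, z) \<in> triples a c A. y \<in> L})
          \<le> real (card (L \<inter> S)) * (real (card (L \<inter> S)) - 1) / 2
          + real (card (L \<inter> R)) * (real (card (L \<inter> R)) - 1) / 2
          + real (card (L \<inter> D)) * (real (card (L \<inter> S)) + real (card (L \<inter> R)))
          + ((real (card (L \<inter> D)) - 1)^2 / 4 + (real (card (L \<inter> D)) + 1) / 2 * real (card (D - L)))
          + real (card (L \<inter> R)) * min (real (card (L \<inter> S))) (real (card (A - S)) + real (card R))"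
      proof (rule card_middle_below_le[OF parts L(1) L(3)])
        fix x y z assume t: "(x, y, z) \<in> triples a c A"
        have xyz: "x \<in> A" "y \<in> A" "z \<in> A" using triples_in[OF t] by auto
        show "z \<notin> S" if "x \<in> R" "y \<in> S"
          using that xyz res[OF t] by (auto simp: R_def S_def Q_def)
        show "z \<in> R" if "x \<in> S" "y \<in> R"
          using that xyz res[OF t] by (auto simp: R_def S_def Q_def)
        show "z \<in> D" if "x \<in> D" "y \<in> D"
          using that xyz res[OF t] by (auto simp: D_def S_def Q_def)
      qed auto
      have union: "card (X \<union> Y) = card X + card Y" if "X \<inter> Y = {}" "finite X" "finite Y"
        for X Y :: "int set" using that by (simp add: card_Un_disjoint)
      have L_parts: "real (card (L \<inter> S)) + real (card (L \<inter> D)) + real (card (L \<inter> R)) = real (card L)"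
      proof -
        have "L = (L \<inter> S) \<union> ((L \<inter> D) \<union> (L \<inter> R))" using L parts by auto
        then have "card L = card (L \<inter> S) + (card (L \<inter> D) + card (L \<inter> R))"
          using union[of "L \<inter> S" "(L \<inter> D) \<union> (L \<inter> R)"] union[of "L \<inter> D" "L \<inter> R"] finLU parts
          by (metis (no_types, lifting) Int_Un_distrib Int_assoc Int_empty_right finite_Int finite_Un inf_left_commute sup_bot_left)
        then show ?thesis by linarith
      qed
      have B_parts: "real (card (A - S)) = real (card (L \<inter> D)) + real (card (L \<inter> R)) + real (card (U - S))"
      proof -
        have "A - S = (L - S) \<union> (U - S)" "(L - S) \<inter> (U - S) = {}" using L by (auto simp: U_def)
        then have "card (A - S) = card (L - S) + card (U - S)" using union finLU by simp
        moreover have "card L = card (L \<inter> S) + card (L - S)" using finLU card_Int_Diff by blast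
        ultimately show ?thesis using L_parts by linarith
      qed
      have R_parts: "card R = card (L \<inter> R) + card (U \<inter> R)"
      proof -
        have "R = (L \<inter> R) \<union> (U \<inter> R)" "(L \<inter> R) \<inter> (U \<inter> R) = {}" by (auto simp: U_def R_def)
        then show ?thesis using union[of "L \<inter> R" "U \<inter> R"] finLU by simp
      qed
      have UR: "card (U \<inter> R) \<le> card (U - S)" by (rule card_mono) (use finLU parts in auto)
      have DL: "card (D - L) \<le> card (U - S)" by (rule card_mono) (use finLU parts in \<open>auto simp: U_def\<close>)
      have AS: "real (card (A - S)) = n - real (card S)"
        using card_Int_Diff[of A S] fin parts(1) by (simp add: n_def Int_absorb1 le_supI1 Un_assoc)
      have "real (card (L \<inter> S)) * (real (card (L \<inter> S)) - 1) / 2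
          + real (card (L \<inter> R)) * (real (card (L \<inter> R)) - 1) / 2
          + real (card (L \<inter> D)) * (real (card (L \<inter> S)) + real (card (L \<inter> R)))
          + ((real (card (L \<inter> D)) - 1)^2 / 4 + (real (card (L \<inter> D)) + 1) / 2 * real (card (D - L)))
          + real (card (L \<inter> R)) * min (real (card (L \<inter> S))) (real (card (A - S)) + real (card R))
          + (real (card (U \<inter> S)) * (real (card (U \<inter> S)) - 1) / 2
          + real (card (U - S)) * (real (card (U - S)) - 1) / 2 + 2 * real (card R) * real (card (U - S)))
          \<le> 99 / 400 * n^2 + (n - 1)"
        by (rule dominant_class_bound[OF cLU cut L_parts n2])
          (use big cR Q R_parts UR DL B_parts AS cS in simp_all)
      then show ?thesis using split lower upper[OF S_def] unfolding n_def by linarith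
    qed (use n2 in \<open>auto simp: f_def\<close>)
  qed
qed


section \<open>The pattern count and its growth constant\<close>

lemma M_plus_eq_card_triples:
  assumes "0 < a" "a < b"
  shows "M_plus {0, a, b} A = card (triples a (b - a) A)"
proof -
  have "bij_betw (\<lambda>(x, d). (x, x + a * d, x + b * d))
      {(x, d). d > 0 \<and> (\<forall>p\<in>{0, a, b}. x + p * d \<in> A)} (triples a (b - a) A)"
  proof (rule bij_betwI')
    fix t assume "t \<in> triples a (b - a) A"
    then obtain x d where "d > 0" "t = (x, x + a * d, x + a * d + (b - a) * d)"
      "x \<in> A" "x + a * d \<in> A" "x + a * d + (b - a) * d \<in> A" unfolding triples_def by blast
    moreover have "x + a * d + (b - a) * d = x + b * d" by (simp add: algebra_simps)
    ultimately show "\<exists>s\<in>{(x, d). d > 0 \<and> (\<forall>p\<in>{0, a, b}. x + p * d \<in> A)}.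
        t = (case s of (x, d) \<Rightarrow> (x, x + a * d, x + b * d))" by force
  next
    fix s assume "s \<in> {(x, d). d > 0 \<and> (\<forall>p\<in>{0, a, b}. x + p * d \<in> A)}"
    then obtain x d where "s = (x, d)" "d > 0" "x \<in> A" "x + a * d \<in> A" "x + b * d \<in> A" by auto
    moreover have "x + b * d = x + a * d + (b - a) * d" by (simp add: algebra_simps)
    ultimately have "(x, x + a * d, x + b * d) \<in> triples a (b - a) A"
      unfolding triples_def by blast
    then show "(case s of (x, d) \<Rightarrow> (x, x + a * d, x + b * d)) \<in> triples a (b - a) A"
      using \<open>s = (x, d)\<close> by simp
  qed (use assms in \<open>auto simp: algebra_simps\<close>)
  then show ?thesis unfolding M_plus_def by (rule bij_betw_same_card)
qed

lemma card_triples_uminus: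
  "card (triples c a (uminus ` A)) = card (triples a c A)"
proof -
  have "triples c a (uminus ` A) = (\<lambda>(x, y, z). (- z, - y, - x)) ` triples a c A"
  proof (intro equalityI subsetI)
    fix t assume "t \<in> triples c a (uminus ` A)"
    then obtain x y z d where t: "t = (- x, - y, - z)" "x \<in> A" "y \<in> A" "z \<in> A" "d > 0"
      "- y = - x + c * d" "- z = - y + a * d" unfolding triples_def by blast
    then have "(z, y, x) \<in> triples a c A" unfolding triples_def by force
    then show "t \<in> (\<lambda>(x, y, z). (- z, - y, - x)) ` triples a c A" using t(1) by force
  next
    fix t assume "t \<in> (\<lambda>(x, y, z). (- z, - y, - x)) ` triples a c A"
    then obtain x d where "t = (- (x + a * d + c * d), - (x + a * d), - x)" "d > 0"
      "x \<in> A" "x + a * d \<in> A" "x + a * d + c * d \<in> A" unfolding triples_def by force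
    moreover have "- (x + a * d) = - (x + a * d + c * d) + c * d" "- x = - (x + a * d) + a * d"
      by simp_all
    ultimately show "t \<in> triples c a (uminus ` A)" unfolding triples_def by blast
  qed
  moreover have "inj_on (\<lambda>(x, y, z). (- z, - y, - x :: int)) (triples a c A)"
    by (auto simp: inj_on_def)
  ultimately show ?thesis by (simp add: card_image)
qed

lemma M_plus_le:
  fixes a b :: int
  assumes "0 < a" "a < b" "gcd a b = 1" "{0, a, b} \<noteq> {0, 1, 2}" "finite A" "A \<noteq> {}"
  shows "real (M_plus {0, a, b} A) \<le> 99 / 400 * real (card A)^2 + (real (card A) - 1)"
proof -
  have cop: "coprime a (b - a)"
    using assms(3) by (metis coprime_iff_gcd_eq_1 gcd_diff1 gcd.commute)
  \<comment> \<open>If \<open>b - a = 1\<close>, then \<open>a \<ge> 2\<close>, because \<open>P \<noteq> {0, 1, 2}\<close>; now reflect \<open>A\<close>.\<close>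
  consider "2 \<le> b - a" | "b - a = 1" "2 \<le> a"
    using assms(1,2,4) by (cases "2 \<le> b - a"; cases "2 \<le> a") (auto simp: not_le)
  then show ?thesis
  proof cases
    case 1
    then show ?thesis using card_triples_le[OF assms(1) _ cop assms(5,6)] M_plus_eq_card_triples[OF assms(1,2)] by simp
  next
    case 2
    have "real (card (triples 1 a (uminus ` A))) \<le> 99 / 400 * real (card (uminus ` A))^2 + (real (card (uminus ` A)) - 1)"
      by (rule card_triples_le) (use 2 assms in auto)
    moreover have "card (uminus ` A) = card A" by (rule card_image) auto
    ultimately show ?thesis
      using M_plus_eq_card_triples[OF assms(1,2)] card_triples_uminus[of 1 a A] 2(1) by simp
  qed
qed

text \<open>
  The bound passes to the maximum over sets of a given size, and the term \<open>n - 1\<close>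
  vanishes after division by \<open>n\<^sup>2\<close>.
\<close>

lemma gamma_plus_le:
  fixes \<gamma> :: real
  assumes bound: "\<And>A. finite A \<Longrightarrow> A \<noteq> {} \<Longrightarrow> real (M_plus P A) \<le> \<gamma> * real (card A)^2 + (real (card A) - 1)"
  shows "gamma_plus P \<le> ereal \<gamma>"
proof -
  let ?g = "\<lambda>n. \<gamma> + (real n - 1) / real n ^ 2"
  have "real (m_plus P n) / real n ^ 2 \<le> ?g n" if "1 \<le> n" for n
  proof -
    let ?V = "{M_plus P A | A. finite A \<and> card A = n}"
    have le: "real v \<le> \<gamma> * real n ^ 2 + (real n - 1)" if "v \<in> ?V" for v
      using that bound \<open>1 \<le> n\<close> by force
    have "?V \<subseteq> {.. nat \<lfloor>\<gamma> * real n ^ 2 + (real n - 1)\<rfloor>}" using le le_nat_floor by blast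
    then have "finite ?V" by (rule finite_subset) simp
    moreover have "?V \<noteq> {}"
    proof -
      have "card {1..int n} = n" by simp
      then show ?thesis by blast
    qed
    ultimately have "m_plus P n \<in> ?V" unfolding m_plus_def by (rule Max_in)
    then have "real (m_plus P n) \<le> \<gamma> * real n ^ 2 + (real n - 1)" by (rule le)
    then show ?thesis using that by (simp add: field_simps)
  qed
  then have "gamma_plus P \<le> limsup (\<lambda>n. ereal (?g n))"
    unfolding gamma_plus_def by (intro Limsup_mono eventually_sequentiallyI[of 1]) simp
  also have "?g \<longlonglongrightarrow> \<gamma> + (0 - 0)"
  proof -
    have "(\<lambda>n. 1 / real n - (1 / real n)^2) \<longlonglongrightarrow> 0 - 0 ^ 2"
      by (intro tendsto_intros lim_1_over_n)
    moreover have "(\<lambda>n. 1 / real n - (1 / real n)^2) = (\<lambda>n. (real n - 1) / real n ^ 2)"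
    proof
      show "1 / real n - (1 / real n)^2 = (real n - 1) / real n ^ 2" for n
        by (cases "n = 0") (auto simp: field_simps power2_eq_square)
    qed
    ultimately show ?thesis by (intro tendsto_add tendsto_const) simp
  qed
  then have "limsup (\<lambda>n. ereal (?g n)) = ereal \<gamma>"
    by (intro lim_imp_Limsup) auto
  finally show ?thesis .
qed

theorem theorem1p2:
  fixes a b :: int and P :: "int set"
  assumes "0 < a" and "a < b" and "gcd a b = 1"
    and "P = {0, a, b}" and "P \<noteq> {0, 1, 2}"
  shows "(\<forall>A :: int set. \<forall>n :: nat. finite A \<and> A \<noteq> {} \<and> card A = n \<longrightarrow>
            real (M_plus P A) \<le> 99 / 400 * real n ^ 2 + (real n - 1))
         \<and> gamma_plus P \<le> ereal (99 / 400)"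
proof -
  have bound: "real (M_plus P A) \<le> 99 / 400 * real (card A)^2 + (real (card A) - 1)"
    if "finite A" "A \<noteq> {}" for A
    using M_plus_le[OF assms(1-3) _ that] assms(4,5) by simp
  then show ?thesis using gamma_plus_le[OF bound] by blast
qed

end
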